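(* Let $(N,m_0)$ be an ordinary Petri net with uncontrollable transition set $T_u$, let $(\omega,k)$ be a linear constraint, let $t\in T_u$, and let $W=\varphi((\omega,k),t)$. Then $(Q_{(\omega,k)})_t=Q_{\vee(W)}$.
   Context: $\mathbb N=\{0,1,2,\dots\}$. An ordinary Petri net is $N=(P,T,F)$ with $P$ (places), $T$ (transitions) finite, nonempty, disjoint, and $F\subseteq(P\times T)\cup(T\times P)$; $T=T_u\cup T_c$ is partitioned into uncontrollable and controllable transitions. For a node $x$, ${}^\bullet x=\{y:(y,x)\in F\}$ and $x^\bullet=\{y:(x,y)\in F\}$. The incidence matrix $[N]$ has entries $[N](p,t)=-1$ if $p\in{}^\bullet t\setminus t^\bullet$, $1$ if $p\in t^\bullet\setminus{}^\bullet t$, and $0$ otherwise. A marking is a map $m:P\to\mathbb N$; $\mathcal M=\mathbb N^{|P|}$ is the set of all markings. A transition $t$ is enabled at $m$ if $m(p)>0$ for all $p\in{}^\bullet t$; then it can fire, written $m[t\rangle m'$, with $m'(p)=m(p)+[N](p,t)$. $R_t(N,m)$ is the set of markings (including $m$) reachable from $m$ by firing only $t$. For $Q\subseteq\mathcal M$, $\bar Q=\mathcal M\setminus Q$. For $Q\subseteq\mathcal M$ and $t\in T_u$, the escaping-marking set is $\Gamma(Q,t)=\{m\in Q:\exists m'\in R_t(N,m),\ m'\in\bar Q\}$, and the transforming marking set is $Q_t=Q\setminus\Gamma(Q,t)$. A linear constraint is a pair $(\omega,k)$ with $\omega:P\to\mathbb N$ a weight vector and $k$ an integer; it requires $\omega\cdot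 m\le k$. $Q_{(\omega,k)}=\{m\in\mathcal M:\omega\cdot m\le k\}$, and for a finite set $W$ of linear constraints $Q_{\vee(W)}=\bigcup_{(\omega,k)\in W}Q_{(\omega,k)}$. The weight of transitions under $(\omega,k)$ is the row vector $\varpi=\omega\cdot[N]$, i.e. $\varpi(t)=\sum_{p}\omega(p)[N](p,t)$. For a linear constraint $(\omega,k)$, $t\in T_u$ and $p\in P$, define $\rho((\omega,k),t,p)=(\omega',k')$ by $k'=k$ and, for every $p'\in P$: $\omega'(p')=\omega(p')$ if $p'\ne p$ or $p'\notin{}^\bullet t$; $\omega'(p')=\omega(p')+\varpi(t)$ if $p'=p$ and $p'\in{}^\bullet t\setminus t^\bullet$; $\omega'(p')=k+1$ if $p'=p$ and $p'\in{}^\bullet t\cap t^\bullet$. Define $\varphi((\omega,k),t)=\{(\omega,k)\}$ if $\varpi(t)\le0$, and $\varphi((\omega,k),t)=\bigcup_{p\in{}^\bullet t}\{\rho((\omega,k),t,p)\}$ if $\varpi(t)>0$.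
   Formalization: For a self-loop input place the new weight k+1 is replaced by max(k+1, 0), since for k ≤ −2 the value k+1 is negative, hence not an admissible weight, and taken literally would make the claim false; for k ≥ −1 nothing changes. *)

theory Defs
  imports Complex_Main "HOL-Library.FuncSet"
begin

text \<open>Places and transitions are drawn from one type of nodes, so that the flow relation is a
  single relation on nodes and disjointness of places and transitions is a genuine condition.\<close>

record 'v petri_net =
  places :: "'v set"
  transitions :: "'v set"
  uncontrollable :: "'v set"
  controllable :: "'v set"
  flow :: "('v \<times> 'v) set"

locale ordinary_petri_net =
  fixes N :: "'v petri_net"
  assumes finite_places: "finite (places N)"
    and places_nonempty: "places N \<noteq> {}"
    and finite_transitions: "finite (transitions N)"
    and transitions_nonempty: "transitions N \<noteq> {}"
    and places_transitions_disjoint: "places N \<inter> transitions N = {}"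
    and flow_subset:
      "flow N \<subseteq> (places N \<times> transitions N) \<union> (transitions N \<times> places N)"
    and transitions_eq: "transitions N = uncontrollable N \<union> controllable N"
    and control_disjoint: "uncontrollable N \<inter> controllable N = {}"

definition preset :: "'v petri_net \<Rightarrow> 'v \<Rightarrow> 'v set" where
  "preset N x = {y. (y, x) \<in> flow N}"

definition postset :: "'v petri_net \<Rightarrow> 'v \<Rightarrow> 'v set" where
  "postset N x = {y. (x, y) \<in> flow N}"

definition incidence :: "'v petri_net \<Rightarrow> 'v \<Rightarrow> 'v \<Rightarrow> int" where
  "incidence N p t =
     (if p \<in> preset N t - postset N t then - 1
      else if p \<in> postset N t - preset N t then 1
      else 0)"

text \<open>Maps from the set of places to the naturals (markings, and below also weight vectors) are
  extensional functions, so that equality of maps is equality on the places.\<close>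

definition markings :: "'v petri_net \<Rightarrow> ('v \<Rightarrow> nat) set" where
  "markings N = places N \<rightarrow>\<^sub>E UNIV"

definition enabled :: "'v petri_net \<Rightarrow> ('v \<Rightarrow> nat) \<Rightarrow> 'v \<Rightarrow> bool" where
  "enabled N m t \<longleftrightarrow> (\<forall>p\<in>preset N t. m p > 0)"

definition fires :: "'v petri_net \<Rightarrow> 'v \<Rightarrow> ('v \<Rightarrow> nat) \<Rightarrow> ('v \<Rightarrow> nat) \<Rightarrow> bool" where
  "fires N t m m' \<longleftrightarrow>
     m \<in> markings N \<and> m' \<in> markings N \<and> enabled N m t \<and>
     (\<forall>p\<in>places N. int (m' p) = int (m p) + incidence N p t)"

definition reach_by :: "'v petri_net \<Rightarrow> 'v \<Rightarrow> ('v \<Rightarrow> nat) \<Rightarrow> ('v \<Rightarrow> nat) set" where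
  "reach_by N t m = {m'. (fires N t)\<^sup>*\<^sup>* m m'}"

definition escaping ::
    "'v petri_net \<Rightarrow> ('v \<Rightarrow> nat) set \<Rightarrow> 'v \<Rightarrow> ('v \<Rightarrow> nat) set" where
  "escaping N Q t = {m \<in> Q. \<exists>m'\<in>reach_by N t m. m' \<in> markings N - Q}"

definition transforming ::
    "'v petri_net \<Rightarrow> ('v \<Rightarrow> nat) set \<Rightarrow> 'v \<Rightarrow> ('v \<Rightarrow> nat) set" where
  "transforming N Q t = Q - escaping N Q t"

type_synonym 'v linear_constraint = "('v \<Rightarrow> nat) \<times> int"

definition linear_constraints :: "'v petri_net \<Rightarrow> 'v linear_constraint set" where
  "linear_constraints N = (places N \<rightarrow>\<^sub>E UNIV) \<times> UNIV"

definition satisfying :: "'v petri_net \<Rightarrow> 'v linear_constraint \<Rightarrow> ('v \<Rightarrow> nat) set" where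
  "satisfying N c = {m \<in> markings N. int (\<Sum>p\<in>places N. fst c p * m p) \<le> snd c}"

definition satisfying_some ::
    "'v petri_net \<Rightarrow> 'v linear_constraint set \<Rightarrow> ('v \<Rightarrow> nat) set" where
  "satisfying_some N W = (\<Union>c\<in>W. satisfying N c)"

definition transition_weight :: "'v petri_net \<Rightarrow> ('v \<Rightarrow> nat) \<Rightarrow> 'v \<Rightarrow> int" where
  "transition_weight N w t = (\<Sum>p\<in>places N. int (w p) * incidence N p t)"

text \<open>Weights are natural numbers, so the two integer expressions are converted by \<^const>\<open>nat\<close>.
  In the only case where \<open>rho\<close> is used, namely \<^prop>\<open>transition_weight N w t > 0\<close>, the
  first conversion is exact; the second is exact for \<open>k \<ge> - 1\<close>. For \<open>k < - 1\<close> the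
  value \<open>k + 1\<close> is not an admissible weight, and the weight is taken to be \<open>0\<close>.\<close>

definition rho ::
    "'v petri_net \<Rightarrow> 'v linear_constraint \<Rightarrow> 'v \<Rightarrow> 'v \<Rightarrow> 'v linear_constraint" where
  "rho N c t p = (case c of (w, k) \<Rightarrow>
     (\<lambda>p'\<in>places N.
        if p' \<noteq> p \<or> p' \<notin> preset N t then w p'
        else if p' \<in> preset N t - postset N t then nat (int (w p') + transition_weight N w t)
        else nat (k + 1),
      k))"

definition phi ::
    "'v petri_net \<Rightarrow> 'v linear_constraint \<Rightarrow> 'v \<Rightarrow> 'v linear_constraint set" where
  "phi N c t =
     (if transition_weight N (fst c) t \<le> 0 then {c} else (\<Union>p\<in>preset N t. {rho N c t p}))"

end

theory Submission
  imports Defs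
begin

text \<open>Let \<open>S p\<close> be the set of markings satisfying the constraint \<open>rho N (\<omega>, k) t p\<close>. When \<open>t\<close> has
  positive weight, a firing of \<open>t\<close> neither enters nor leaves \<open>S p\<close>: if \<open>p\<close> only loses tokens, each
  firing raises \<open>\<omega> \<cdot> m\<close> by the weight of \<open>t\<close> and lowers \<open>m p\<close> by one, so \<open>\<omega> \<cdot> m\<close> plus the weight of
  \<open>t\<close> times \<open>m p\<close> is invariant; if \<open>p\<close> is a self-loop place, \<open>S p\<close> requires \<open>m p = 0\<close>, which disables
  \<open>t\<close>. As \<open>S p\<close> lies in the original constraint set \<open>Q\<close>, none of its markings escapes. Conversely, a
  marking of \<open>Q\<close> outside every \<open>S p\<close> has \<open>m p > 0\<close> for all input places \<open>p\<close>, so \<open>t\<close> is enabled and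
  its successor is again outside every \<open>S p\<close>. Every firing increases \<open>\<omega> \<cdot> m\<close>, hence iterating leaves
  \<open>Q\<close>.\<close>

definition marking_weight :: "'v petri_net \<Rightarrow> ('v \<Rightarrow> nat) \<Rightarrow> ('v \<Rightarrow> nat) \<Rightarrow> int" where
  "marking_weight N w m = (\<Sum>p\<in>places N. int (w p) * int (m p))"

lemma marking_weight_nonneg: "marking_weight N w m \<ge> 0"
  unfolding marking_weight_def by (intro sum_nonneg) simp

lemma satisfying_iff:
  "m \<in> satisfying N (w, k) \<longleftrightarrow> m \<in> markings N \<and> marking_weight N w m \<le> k"
  by (simp add: satisfying_def marking_weight_def)

lemma marking_weight_fires:
  assumes "fires N t m m'"
  shows "marking_weight N w m' = marking_weight N w m + transition_weight N w t"
proof -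
  have "marking_weight N w m' = (\<Sum>p\<in>places N. int (w p) * (int (m p) + incidence N p t))"
    using assms unfolding marking_weight_def fires_def by (intro sum.cong) auto
  then show ?thesis
    by (simp add: marking_weight_def transition_weight_def distrib_left sum.distrib)
qed

text \<open>\<open>rho\<close> alters a weight vector at one place only, so this compares the
  weighted sums before and after.\<close>

lemma marking_weight_update:
  assumes "finite (places N)" "p \<in> places N"
    and "\<And>q. q \<in> places N \<Longrightarrow> q \<noteq> p \<Longrightarrow> w' q = w q"
  shows "marking_weight N w' m = marking_weight N w m + (int (w' p) - int (w p)) * int (m p)"
proof -
  have "(\<Sum>q\<in>places N - {p}. int (w' q) * int (m q)) = (\<Sum>q\<in>places N - {p}. int (w q) * int (m q))"
    using assms(3) by (intro sum.cong) auto
  then show ?thesis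
    using assms(1,2) by (simp add: marking_weight_def sum.remove left_diff_distrib)
qed

lemma reach_by_closed:
  assumes "m' \<in> reach_by N t m" "m \<in> S"
    and "\<And>a b. fires N t a b \<Longrightarrow> a \<in> S \<Longrightarrow> b \<in> S"
  shows "m' \<in> S"
proof -
  have "(fires N t)\<^sup>*\<^sup>* m m'"
    using assms(1) by (simp add: reach_by_def)
  then show ?thesis
    by induction (auto intro: assms)
qed

lemma subset_transforming:
  assumes "S \<subseteq> Q" and "\<And>a b. fires N t a b \<Longrightarrow> a \<in> S \<Longrightarrow> b \<in> S"
  shows "S \<subseteq> transforming N Q t"
  using assms reach_by_closed[where S = S and N = N and t = t]
  unfolding transforming_def escaping_def by blast

text \<open>Whatever \<open>m'\<close> reaches, \<open>m\<close> reaches too; this carries the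
  hypothesis along a firing in the later induction.\<close>

lemma transforming_closed:
  assumes "m \<in> transforming N Q t" "fires N t m m'"
  shows "m' \<in> transforming N Q t"
proof -
  have "reach_by N t m' \<subseteq> reach_by N t m"
    using assms(2) by (auto simp: reach_by_def intro: converse_rtranclp_into_rtranclp)
  moreover have "m' \<in> reach_by N t m'" "m' \<in> markings N"
    using assms(2) by (auto simp: reach_by_def fires_def)
  ultimately show ?thesis
    using assms(1) unfolding transforming_def escaping_def by blast
qed

context ordinary_petri_net
begin

lemma preset_subset_places:
  assumes "t \<in> transitions N"
  shows "preset N t \<subseteq> places N"
  using assms flow_subset places_transitions_disjoint by (auto simp: preset_def)

lemma enabled_fires:
  assumes "m \<in> markings N" "enabled N m t"
  obtains m' where "fires N t m m'"
proof
  let ?m' = "\<lambda>p\<in>places N. nat (int (m p) + incidence N p t)"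
  \<comment> \<open>This makes \<open>nat\<close> exact: the incidence is negative only at input
    places, and these are marked.\<close>
  have "int (m p) + incidence N p t \<ge> 0" for p
    using assms(2) by (auto simp: enabled_def incidence_def)
  then show "fires N t m ?m'"
    using assms by (auto simp: fires_def markings_def)
qed

text \<open>The weight at \<open>p\<close> grows by the weight of \<open>t\<close>, whose
  nonnegativity makes the \<open>nat\<close> in \<open>rho\<close> exact.\<close>

lemma satisfying_rho_pure_iff:
  assumes "t \<in> transitions N" "p \<in> preset N t - postset N t" "transition_weight N w t \<ge> 0"
  shows "m \<in> satisfying N (rho N (w, k) t p) \<longleftrightarrow>
    m \<in> markings N \<and> marking_weight N w m + transition_weight N w t * int (m p) \<le> k"
proof -
  have "p \<in> places N"
    using assms preset_subset_places by blast
  then show ?thesis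
    using assms marking_weight_update[OF finite_places \<open>p \<in> places N\<close>, of "fst (rho N (w, k) t p)" w m]
    by (simp add: rho_def satisfying_iff)
qed

text \<open>With weight \<open>k + 1\<close> at \<open>p\<close>, a single token there already
  exceeds the bound \<open>k\<close>.\<close>

lemma satisfying_rho_loop_iff:
  assumes "t \<in> transitions N" "p \<in> preset N t \<inter> postset N t"
  shows "m \<in> satisfying N (rho N (w, k) t p) \<longleftrightarrow> m \<in> satisfying N (w, k) \<and> m p = 0"
proof (cases "k \<ge> 0")
  \<comment> \<open>For negative \<open>k\<close> the truncated weight is harmless: weighted sums
    are nonnegative, so both sides are false.\<close>
  case False
  then have "\<not> marking_weight N v m \<le> k" for v
    using marking_weight_nonneg[of N v m] by linarith
  then show ?thesis
    by (simp add: rho_def satisfying_iff)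
next
  case True
  have p: "p \<in> places N"
    using assms preset_subset_places by blast
  let ?v = "fst (rho N (w, k) t p)"
  have v: "int (?v p) = k + 1"
    using assms p True by (simp add: rho_def)
  have upd: "marking_weight N ?v m = marking_weight N w m + (int (?v p) - int (w p)) * int (m p)"
    using p by (intro marking_weight_update finite_places) (auto simp: rho_def)
  have "\<not> marking_weight N ?v m \<le> k" if "m p > 0"
  proof -
    have "k + 1 \<le> int (?v p) * int (m p)"
      using v that True mult_left_mono[of 1 "int (m p)" "k + 1"] by simp
    also have "\<dots> \<le> marking_weight N ?v m"
      unfolding marking_weight_def using p finite_places
      by (intro member_le_sum[where f = "\<lambda>p. int (?v p) * int (m p)"]) auto
    finally show ?thesis by linarith
  qed
  moreover have "m \<in> satisfying N (rho N (w, k) t p) \<longleftrightarrow>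
      m \<in> markings N \<and> marking_weight N ?v m \<le> k"
    using satisfying_iff[of m N ?v k] by (simp add: rho_def)
  ultimately show ?thesis
    using upd by (cases "m p = 0") (auto simp: satisfying_iff)
qed

lemma satisfying_rho_subset:
  assumes "t \<in> transitions N" "p \<in> preset N t" "transition_weight N w t \<ge> 0"
  shows "satisfying N (rho N (w, k) t p) \<subseteq> satisfying N (w, k)"
proof (cases "p \<in> postset N t")
  case True
  then show ?thesis
    using assms satisfying_rho_loop_iff by auto
next
  case False
  show ?thesis
  proof
    fix m assume "m \<in> satisfying N (rho N (w, k) t p)"
    then have "m \<in> markings N" "marking_weight N w m + transition_weight N w t * int (m p) \<le> k"
      using assms False satisfying_rho_pure_iff by auto
    moreover have "0 \<le> transition_weight N w t * int (m p)"
      using assms(3) by simp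
    ultimately show "m \<in> satisfying N (w, k)"
      unfolding satisfying_iff by linarith
  qed
qed

text \<open>The only altered weight is multiplied by \<open>m p = 0\<close>.\<close>

lemma satisfying_rho_unmarked:
  assumes "t \<in> transitions N" "p \<in> preset N t" "transition_weight N w t \<ge> 0" "m p = 0"
  shows "m \<in> satisfying N (rho N (w, k) t p) \<longleftrightarrow> m \<in> satisfying N (w, k)"
  using assms satisfying_rho_loop_iff[of t p m w k] satisfying_rho_pure_iff[of t p w m k]
  by (cases "p \<in> postset N t") (auto simp: satisfying_iff)

lemma satisfying_rho_fires:
  assumes "t \<in> transitions N" "p \<in> preset N t" "transition_weight N w t \<ge> 0" "fires N t m m'"
  shows "m' \<in> satisfying N (rho N (w, k) t p) \<longleftrightarrow> m \<in> satisfying N (rho N (w, k) t p)"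
proof -
  have p: "p \<in> places N"
    using assms preset_subset_places by blast
  have m: "m \<in> markings N" "m' \<in> markings N" "m p > 0"
    and m'p: "int (m' p) = int (m p) + incidence N p t"
    using assms p by (auto simp: fires_def enabled_def)
  show ?thesis
  proof (cases "p \<in> postset N t")
    case True
    then have "m' p = m p"
      using m'p assms(2) by (simp add: incidence_def)
    \<comment> \<open>Both sides are false, since \<open>p\<close> is marked before and after the
      firing.\<close>
    then show ?thesis
      using True assms m satisfying_rho_loop_iff by auto
  next
    case False
    then have dec: "int (m' p) = int (m p) - 1"
      using m'p assms by (simp add: incidence_def)
    have "marking_weight N w m' + transition_weight N w t * int (m' p)
        = marking_weight N w m + transition_weight N w t * int (m p)"
      unfolding marking_weight_fires[OF assms(4)] dec by (simp add: algebra_simps)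
    then show ?thesis
      using False assms m satisfying_rho_pure_iff by auto
  qed
qed

text \<open>If \<open>t\<close> has no input place, this says that the transforming set is
  empty.\<close>

lemma transforming_subset_satisfying_rho:
  assumes "t \<in> transitions N" "transition_weight N w t > 0"
    and "m \<in> transforming N (satisfying N (w, k)) t"
  shows "\<exists>p\<in>preset N t. m \<in> satisfying N (rho N (w, k) t p)"
  using assms(3)
\<comment> \<open>The measure is the slack in the constraint. The successor also satisfies the
  constraint, so its slack is nonnegative and the decrease is strict despite
  \<open>nat\<close>.\<close>
proof (induction "nat (k - marking_weight N w m)" arbitrary: m rule: less_induct)
  case less
  have m: "m \<in> satisfying N (w, k)"
    using less.prems by (simp add: transforming_def)
  show ?case
  proof (cases "enabled N m t")
    case False
    then obtain p where "p \<in> preset N t" "m p = 0"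
      by (auto simp: enabled_def)
    then show ?thesis
      using satisfying_rho_unmarked[of t p w m k] assms(1,2) m by auto
  next
    case True
    have "m \<in> markings N"
      using m by (simp add: satisfying_iff)
    then obtain m' where m': "fires N t m m'"
      using True by (rule enabled_fires)
    have t': "m' \<in> transforming N (satisfying N (w, k)) t"
      using less.prems m' by (rule transforming_closed)
    have "nat (k - marking_weight N w m') < nat (k - marking_weight N w m)"
      using t' marking_weight_fires[OF m', of w] assms(2)
      by (auto simp: transforming_def satisfying_iff)
    \<comment> \<open>The place found for \<open>m'\<close> also serves \<open>m\<close>, by
      invariance under firing.\<close>
    from less.hyps[OF this t'] show ?thesis
      using satisfying_rho_fires[OF assms(1) _ _ m'] assms(2) by auto
  qed
qed

end

theorem theorem7:
  fixes N :: "'v petri_net" and m0 :: "'v \<Rightarrow> nat"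
    and \<omega> :: "'v \<Rightarrow> nat" and k :: int and t :: 'v
    and W :: "'v linear_constraint set"
  assumes "ordinary_petri_net N"
    and "m0 \<in> markings N"
    and "(\<omega>, k) \<in> linear_constraints N"
    and "t \<in> uncontrollable N"
    and "W = phi N (\<omega>, k) t"
  shows "transforming N (satisfying N (\<omega>, k)) t = satisfying_some N W"
proof -
  interpret ordinary_petri_net N by fact
  have t: "t \<in> transitions N"
    using assms(4) transitions_eq by blast
  let ?Q = "satisfying N (\<omega>, k)"
  show ?thesis
  proof (cases "transition_weight N \<omega> t \<le> 0")
    case True
    \<comment> \<open>A firing of nonpositive weight cannot raise the weighted sum, so
      \<open>?Q\<close> itself is closed under firing.\<close>
    have "?Q \<subseteq> transforming N ?Q t"
    proof (rule subset_transforming)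
      fix a b assume "fires N t a b" "a \<in> ?Q"
      then show "b \<in> ?Q"
        using True marking_weight_fires[of N t a b \<omega>] by (auto simp: satisfying_iff fires_def)
    qed simp
    then have "transforming N ?Q t = ?Q"
      by (auto simp: transforming_def)
    then show ?thesis
      using True assms(5) by (simp add: phi_def satisfying_some_def)
  next
    case False
    then have W: "satisfying_some N W = (\<Union>p\<in>preset N t. satisfying N (rho N (\<omega>, k) t p))"
      using assms(5) by (simp add: phi_def satisfying_some_def)
    have "satisfying N (rho N (\<omega>, k) t p) \<subseteq> transforming N ?Q t" if "p \<in> preset N t" for p
      using False t that satisfying_rho_subset satisfying_rho_fires
      by (intro subset_transforming) auto
    then show ?thesis
      using False t transforming_subset_satisfying_rho[of t \<omega> _ k] unfolding W
      by (intro equalityI subsetI) auto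
  qed
qed

end
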